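(* Let $A\in\mathbb{R}^{m\times n}$. Then for all $b\in\mathbb{R}^m$ such that $P_{A,b}:=\{x\in\mathbb{R}^n: Ax\le b\}\neq\emptyset$ and all $u\in\mathbb{R}^n$ $$\mathrm{dist}(u,P_{A,b})\le H(A)\cdot\mathrm{dist}(b,Au+\mathbb{R}^m_+)\le H(A)\cdot\|(Au-b)_+\|.$$ Furthermore, the first bound is tight: if $H(A)>0$ then there exist $b\in\mathbb{R}^m$ such that $P_{A,b}\neq\emptyset$ and $u\notin P_{A,b}$ such that $$\mathrm{dist}(u,P_{A,b})=H(A)\cdot\mathrm{dist}(b,Au+\mathbb{R}^m_+).$$
   Context: $\mathbb{R}^n$ and $\mathbb{R}^m$ are each endowed with an arbitrary norm, denoted $\|\cdot\|$. $\mathrm{dist}(u,S)=\inf\{\|u-x\|:x\in S\}$; $(y)_+=\max(0,y)$ componentwise; vector inequalities are componentwise. For $J\subseteq\{1,\dots,m\}$, $A_J\in\mathbb{R}^{J\times n}$ is the submatrix of $A$ formed by the rows in $J$, and $v_J$ is the subvector of $v\in\mathbb{R}^m$ indexed by $J$. The set $J$ is $A$-surjective if $A_J\mathbb{R}^n+\mathbb{R}^J_+=\mathbb{R}^J$. Let $\mathcal{S}(A)=\{J\subseteq\{1,\dots,m\}: J\text{ is }A\text{-surjective}\}$ (the empty set belongs to it). Define $$H(A)=\max_{J\in\mathcal{S}(A)}H_J(A),\qquad H_J(A)=\max_{v\in\mathbb{R}^m,\ \|v\|\le1}\ \min_{x\in\mathbb{R}^n,\ A_Jx\le v_J}\|x\|,$$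 with $H_J(A)=0$ if $J=\emptyset$. *)

theory Defs
  imports "HOL-Analysis.Analysis"
begin

text \<open>
  The library norm on \<^typ>\<open>real ^ 'n\<close> is the Euclidean one, so arbitrary norms are
  passed around explicitly as functions.
\<close>

definition is_norm :: "('a::real_vector \<Rightarrow> real) \<Rightarrow> bool" where
  "is_norm N \<longleftrightarrow>
     (\<forall>x. N x = 0 \<longleftrightarrow> x = 0) \<and>
     (\<forall>c x. N (c *\<^sub>R x) = \<bar>c\<bar> * N x) \<and>
     (\<forall>x y. N (x + y) \<le> N x + N y)"

definition dist_to :: "('a::real_vector \<Rightarrow> real) \<Rightarrow> 'a \<Rightarrow> 'a set \<Rightarrow> real" where
  "dist_to N u S = (INF x\<in>S. N (u - x))"

definition pos_part :: "real ^ 'm \<Rightarrow> real ^ 'm" where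
  "pos_part y = (\<chi> i. max 0 (y $ i))"

definition solution_set :: "real ^ 'n ^ 'm \<Rightarrow> real ^ 'm \<Rightarrow> (real ^ 'n) set" where
  "solution_set A b = {x. A *v x \<le> b}"

definition upper_set :: "real ^ 'm \<Rightarrow> (real ^ 'm) set" where
  "upper_set y = {y + s | s. 0 \<le> s}"

text \<open>
  For a set \<open>J\<close> of row indices, the space of real vectors indexed by \<open>J\<close> is
  \<open>J \<rightarrow>\<^sub>E UNIV\<close>. The subvector of \<open>A *v x\<close> indexed by \<open>J\<close> is the product of the row
  submatrix of \<open>A\<close> given by \<open>J\<close> with \<open>x\<close>.
\<close>

definition subvector :: "'m set \<Rightarrow> real ^ 'm \<Rightarrow> ('m \<Rightarrow> real)" where
  "subvector J v = (\<lambda>i\<in>J. v $ i)"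

definition surjective_set :: "real ^ 'n ^ 'm \<Rightarrow> 'm set \<Rightarrow> bool" where
  "surjective_set A J \<longleftrightarrow>
     {(\<lambda>i\<in>J. y i + s i) | y s.
        y \<in> range (\<lambda>x. subvector J (A *v x)) \<and> s \<in> J \<rightarrow>\<^sub>E {0..}} = (J \<rightarrow>\<^sub>E UNIV)"

text \<open>
  \<open>GREATEST\<close> and \<open>LEAST\<close> are the maximum and the minimum of a set of reals whenever these
  are attained. For surjective \<open>J\<close> both are: the minimum is a least norm over a nonempty
  closed set, and it is a finite convex, hence continuous, function of \<open>v\<close>, which is
  maximised over a compact ball. The constraint below is between the subvectors
  indexed by \<open>J\<close>, compared componentwise on \<open>J\<close>.
\<close>

definition hoffman_set ::
  "(real ^ 'n \<Rightarrow> real) \<Rightarrow> (real ^ 'm \<Rightarrow> real) \<Rightarrow> real ^ 'n ^ 'm \<Rightarrow> 'm set \<Rightarrow> real" where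
  "hoffman_set Nn Nm A J =
     (if J = {} then 0
      else GREATEST h. \<exists>v. Nm v \<le> 1 \<and>
             h = (LEAST r. \<exists>x. (\<forall>i\<in>J. subvector J (A *v x) i \<le> subvector J v i) \<and> r = Nn x))"

definition hoffman ::
  "(real ^ 'n \<Rightarrow> real) \<Rightarrow> (real ^ 'm \<Rightarrow> real) \<Rightarrow> real ^ 'n ^ 'm \<Rightarrow> real" where
  "hoffman Nn Nm A = Max {hoffman_set Nn Nm A J | J. surjective_set A J}"

end

theory Submission
  imports Defs
begin

text \<open>
  Write \<open>c = b - A u\<close>. Translating by \<open>u\<close>, the distance \<open>r\<close> from \<open>u\<close> to the polyhedron is
  the infimum of the norms of the solutions of \<open>A z \<le> c\<close>, and the distance from \<open>b\<close> to
  \<open>A u + \<real>\<^sup>m\<^sub>+\<close> is the infimum of the norms of the vectors \<open>y \<le> c\<close>.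

  The heart of the upper bound is that the infeasibility of \<open>A z \<le> c\<close> in the open ball of
  radius \<open>r\<close> is already caused by the rows in some \<open>A\<close>-surjective set \<open>J\<close>
  (\<open>surjective_blocking_rows\<close>). One takes \<open>J\<close> minimal among the sets of rows that cause
  it. If \<open>J\<close> were not surjective, its rows would satisfy a nontrivial relation with
  nonnegative coefficients, and in the style of Helly's theorem this relation would make one
  row of \<open>J\<close> redundant. For this \<open>J\<close> every solution of \<open>A\<^sub>J z \<le> c\<^sub>J\<close> has norm at least \<open>r\<close>,
  so the same holds for the smaller solution set of \<open>A\<^sub>J z \<le> y\<^sub>J\<close> whenever \<open>y \<le> c\<close>. Since \<open>J\<close>
  is surjective, scaling \<open>y\<close> to the unit sphere gives a solution of norm at most
  \<open>H\<^sub>J(A) \<parallel>y\<parallel>\<close>, whence \<open>r \<le> H(A) \<parallel>y\<parallel>\<close>.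

  For tightness, let \<open>J\<close> and \<open>v\<close> attain \<open>H(A)\<close>, let \<open>x\<close> be a solution of
  \<open>A\<^sub>J x \<le> v\<^sub>J\<close> of least norm, put \<open>u = 0\<close>, and let \<open>b\<close> agree with \<open>v\<close> on \<open>J\<close> while
  being so large elsewhere that \<open>x\<close> satisfies the other inequalities too.
\<close>

section \<open>Arbitrary norms on Euclidean space\<close>

context
  fixes N :: "'a::euclidean_space \<Rightarrow> real"
  assumes N: "is_norm N"
begin

lemma is_norm_zero: "N 0 = 0"
  using N by (simp add: is_norm_def)

lemma is_norm_scale: "N (c *\<^sub>R x) = \<bar>c\<bar> * N x"
  using N by (simp add: is_norm_def)

lemma is_norm_triangle: "N (x + y) \<le> N x + N y"
  using N by (simp add: is_norm_def)

lemma is_norm_eq_zero: "N x = 0 \<longleftrightarrow> x = 0"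
  using N by (simp add: is_norm_def)

lemma is_norm_minus: "N (- x) = N x"
  using is_norm_scale[of "-1" x] by simp

lemma is_norm_nonneg: "0 \<le> N x"
  using is_norm_triangle[of x "- x"] by (simp add: is_norm_minus is_norm_zero)

lemma is_norm_segment:
  assumes "0 \<le> t" "t \<le> 1"
  shows "N ((1 - t) *\<^sub>R x + t *\<^sub>R y) \<le> (1 - t) * N x + t * N y"
  using is_norm_triangle[of "(1 - t) *\<^sub>R x" "t *\<^sub>R y"] assms by (simp add: is_norm_scale)

lemma is_norm_convex_on: "convex_on UNIV N"
  by (rule convex_onI) (auto intro: is_norm_segment)

lemma is_norm_continuous_on: "continuous_on S N"
  using convex_on_continuous[OF open_UNIV is_norm_convex_on] continuous_on_subset by blast

lemma is_norm_ball_convex: "convex {x. N x < r}"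
  unfolding convex_alt
proof (intro ballI allI impI)
  fix x y and t :: real
  assume x: "x \<in> {x. N x < r}" and y: "y \<in> {x. N x < r}" and t: "0 \<le> t \<and> t \<le> 1"
  have "N ((1 - t) *\<^sub>R x + t *\<^sub>R y) \<le> (1 - t) * N x + t * N y"
    using t by (intro is_norm_segment) auto
  also have "\<dots> < r" using x y t by (intro convex_bound_lt) auto
  finally show "(1 - t) *\<^sub>R x + t *\<^sub>R y \<in> {x. N x < r}" by simp
qed

text \<open>
  Equivalence with the Euclidean norm: \<open>N\<close> has a positive minimum on the Euclidean unit
  sphere.
\<close>

lemma is_norm_sublevel_compact: "compact {x. N x \<le> r}"
proof -
  have "sphere (0::'a) 1 \<noteq> {}" by simp
  then obtain x0 where x0: "x0 \<in> sphere 0 1" and min: "\<And>x. x \<in> sphere 0 1 \<Longrightarrow> N x0 \<le> N x"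
    using continuous_attains_inf[OF compact_sphere _ is_norm_continuous_on] by metis
  have pos: "0 < N x0"
    using x0 is_norm_nonneg[of x0] is_norm_eq_zero[of x0] by force
  have lower: "N x0 * norm x \<le> N x" for x
  proof (cases "x = 0")
    case True
    then show ?thesis by (simp add: is_norm_zero)
  next
    case False
    then have "N x0 \<le> N (inverse (norm x) *\<^sub>R x)" by (intro min) simp
    with False show ?thesis by (simp add: is_norm_scale field_simps)
  qed
  have "bounded {x. N x \<le> r}"
    unfolding bounded_iff
  proof (intro exI ballI)
    fix x assume "x \<in> {x. N x \<le> r}"
    with lower[of x] have "N x0 * norm x \<le> r" by simp
    with pos show "norm x \<le> r / N x0" by (simp add: field_simps)
  qed
  moreover have "closed {x. N x \<le> r}"
    by (intro closed_Collect_le is_norm_continuous_on continuous_on_const)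
  ultimately show ?thesis by (simp add: compact_eq_bounded_closed)
qed

lemma is_norm_attains_least:
  assumes "closed S" "S \<noteq> {}"
  obtains x where "x \<in> S" "\<And>y. y \<in> S \<Longrightarrow> N x \<le> N y"
proof -
  from assms obtain a where a: "a \<in> S" by blast
  have "compact (S \<inter> {x. N x \<le> N a})"
    using assms by (simp add: closed_Int_compact is_norm_sublevel_compact)
  moreover have "S \<inter> {x. N x \<le> N a} \<noteq> {}" using a by blast
  ultimately have "\<exists>x \<in> S \<inter> {x. N x \<le> N a}. \<forall>y \<in> S \<inter> {x. N x \<le> N a}. N x \<le> N y"
    using is_norm_continuous_on by (rule continuous_attains_inf)
  then obtain x where "x \<in> S \<inter> {x. N x \<le> N a}"
    and "\<forall>y \<in> S \<inter> {x. N x \<le> N a}. N x \<le> N y" ..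
  then show thesis by (intro that[of x]) force+
qed

lemma dist_to_le:
  assumes "x \<in> S"
  shows "dist_to N u S \<le> N (u - x)"
  unfolding dist_to_def
  by (rule cINF_lower) (use assms is_norm_nonneg in \<open>auto intro!: bdd_belowI2[of _ 0]\<close>)

end

section \<open>Surjective sets of rows\<close>

definition row_solutions :: "real ^ 'n ^ 'm \<Rightarrow> 'm set \<Rightarrow> real ^ 'm \<Rightarrow> (real ^ 'n) set" where
  "row_solutions A J v = {x. \<forall>i\<in>J. (A *v x) $ i \<le> v $ i}"

lemma row_solutions_UNIV: "row_solutions A UNIV v = solution_set A v"
  by (simp add: row_solutions_def solution_set_def less_eq_vec_def)

lemma row_solutions_closed: "closed (row_solutions A J v)"
proof -
  have "row_solutions A J v = (\<Inter>i\<in>J. {x. (A *v x) $ i \<le> v $ i})"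
    by (auto simp: row_solutions_def)
  moreover have "closed {x. (A *v x) $ i \<le> v $ i}" for i
    by (intro closed_Collect_le continuous_intros matrix_vector_mult_linear_continuous_on)
  ultimately show ?thesis by auto
qed

lemma row_solutions_segment:
  assumes "x \<in> row_solutions A J v" "y \<in> row_solutions A J w" "0 \<le> t" "t \<le> 1"
  shows "(1 - t) *\<^sub>R x + t *\<^sub>R y \<in> row_solutions A J ((1 - t) *\<^sub>R v + t *\<^sub>R w)"
  using assms
  by (auto simp: row_solutions_def matrix_vector_right_distrib matrix_vector_mult_scaleR
      intro!: add_mono mult_left_mono)

lemma row_solutions_scale:
  assumes "x \<in> row_solutions A J v" "0 \<le> t"
  shows "t *\<^sub>R x \<in> row_solutions A J (t *\<^sub>R v)"
  using assms by (auto simp: row_solutions_def matrix_vector_mult_scaleR intro!: mult_left_mono)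

text \<open>
  The slack of a solution of the subsystem given by \<open>J\<close> is the vector of the nonnegative
  orthant that completes \<open>A\<^sub>J x\<close> to the right-hand side.
\<close>

lemma surjective_set_iff: "surjective_set A J \<longleftrightarrow> (\<forall>v. row_solutions A J v \<noteq> {})"
proof
  assume surj: "surjective_set A J"
  show "\<forall>v. row_solutions A J v \<noteq> {}"
  proof
    fix v
    have "subvector J v \<in> J \<rightarrow>\<^sub>E UNIV" by (simp add: subvector_def)
    with surj obtain x s where eq: "subvector J v = (\<lambda>i\<in>J. subvector J (A *v x) i + s i)"
        and s: "s \<in> J \<rightarrow>\<^sub>E {0..}"
      unfolding surjective_set_def by blast
    have "(A *v x) $ i \<le> v $ i" if "i \<in> J" for i
      using fun_cong[OF eq, of i] PiE_mem[OF s that] that by (simp add: subvector_def)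
    then show "row_solutions A J v \<noteq> {}" by (auto simp: row_solutions_def)
  qed
next
  assume sol: "\<forall>v. row_solutions A J v \<noteq> {}"
  have "f \<in> {(\<lambda>i\<in>J. y i + s i) | y s.
        y \<in> range (\<lambda>x. subvector J (A *v x)) \<and> s \<in> J \<rightarrow>\<^sub>E {0..}}" if f: "f \<in> J \<rightarrow>\<^sub>E UNIV" for f
  proof -
    from sol obtain x where x: "x \<in> row_solutions A J (\<chi> i. f i)" by blast
    define s where "s = (\<lambda>i\<in>J. f i - (A *v x) $ i)"
    have "s \<in> J \<rightarrow>\<^sub>E {0..}" using x by (auto simp: s_def row_solutions_def)
    moreover have "f = (\<lambda>i\<in>J. subvector J (A *v x) i + s i)"
      using f by (auto simp: s_def subvector_def fun_eq_iff PiE_def extensional_def)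
    ultimately show ?thesis by blast
  qed
  then show "surjective_set A J" unfolding surjective_set_def by auto
qed

text \<open>
  A consequence of convex separation: if \<open>v\<close> is outside the convex cone of solvable
  right-hand sides, a separating functional is nonnegative on the cone, which contains both
  the range of \<open>A\<close> and all vectors that are nonnegative on \<open>J\<close>.
\<close>

lemma not_surjective_row_relation:
  assumes "\<not> surjective_set A J"
  obtains l :: "real ^ 'm" where "l \<noteq> 0" "\<And>i. 0 \<le> l $ i" "\<And>i. i \<notin> J \<Longrightarrow> l $ i = 0"
    "\<And>x. l \<bullet> (A *v x) = 0"
proof -
  from assms obtain v where v: "row_solutions A J v = {}" by (auto simp: surjective_set_iff)
  define C where "C = {w. row_solutions A J w \<noteq> {}}"
  have "convex C"
    unfolding convex_alt C_def using row_solutions_segment by blast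
  then have "convex ((\<lambda>w. w - v) ` C)" by (rule convex_translation_subtract)
  moreover have "0 \<notin> (\<lambda>w. w - v) ` C" using v by (auto simp: C_def)
  ultimately have "\<exists>l. l \<noteq> 0 \<and> (\<forall>w \<in> (\<lambda>w. w - v) ` C. 0 \<le> l \<bullet> w)"
    by (rule separating_hyperplane_set_0)
  then obtain l where l0: "l \<noteq> 0" and "\<forall>w \<in> (\<lambda>w. w - v) ` C. 0 \<le> l \<bullet> w" by blast
  then have sep: "l \<bullet> v \<le> l \<bullet> w" if "w \<in> C" for w
    using that by (simp add: inner_diff_right)
  have nonneg: "0 \<le> l \<bullet> w" if "w \<in> C" for w
  proof (rule ccontr)
    assume neg: "\<not> 0 \<le> l \<bullet> w"
    (* far out on the ray through w the functional falls below its value at v *)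
    define t where "t = (\<bar>l \<bullet> v\<bar> + 1) / - (l \<bullet> w)"
    have "0 \<le> t" unfolding t_def using neg by (intro divide_nonneg_nonneg) auto
    then have "t *\<^sub>R w \<in> C"
      using that row_solutions_scale unfolding C_def by blast
    moreover have "l \<bullet> (t *\<^sub>R w) = - (\<bar>l \<bullet> v\<bar> + 1)"
      using neg by (simp add: t_def field_simps)
    ultimately show False using sep by fastforce
  qed
  have range: "0 \<le> l \<bullet> (A *v x)" for x
    by (rule nonneg) (auto simp: C_def row_solutions_def)
  have orthant: "0 \<le> l \<bullet> axis i c" if "i \<in> J \<Longrightarrow> 0 \<le> c" for i c
    by (rule nonneg) (use that in \<open>auto simp: C_def row_solutions_def axis_def intro!: exI[of _ 0]\<close>)
  show thesis
  proof (rule that[OF l0])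
    show "0 \<le> l $ i" for i using orthant[of i 1] by (simp add: inner_axis)
    show "l $ i = 0" if "i \<notin> J" for i
      using that orthant[of i 1] orthant[of i "-1"] by (simp add: inner_axis)
    show "l \<bullet> (A *v x) = 0" for x
      using range[of x] range[of "- x"] by (simp add: linear_neg[OF matrix_vector_mul_linear])
  qed
qed

text \<open>
  Let \<open>J\<close> be minimal among the sets of rows blocking \<open>B\<close>. By minimality each
  \<open>k \<in> J\<close> has a point \<open>z k \<in> B\<close> violating no inequality of \<open>J\<close> except the one of
  row \<open>k\<close>. Since \<open>J\<close> blocks \<open>B\<close>, the residuals
  \<open>A (z k) - c\<close> can be strictly separated from the vectors nonpositive on \<open>J\<close> by a
  functional \<open>m\<close> with nonnegative coefficients supported on \<open>J\<close>. A relation \<open>l\<close>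
  between the rows of \<open>J\<close>, as provided by the previous lemma, is nonpositive at all
  residuals because the full system is feasible. Subtracting the largest admissible multiple
  of \<open>l\<close> from \<open>m\<close> cancels the coefficient of some row \<open>k\<close>; the result is positive at the
  residual of \<open>z k\<close>, although its \<open>k\<close>-th coefficient is zero and the residual is
  nonpositive at all other rows of \<open>J\<close>.
\<close>

lemma surjective_blocking_rows:
  fixes A :: "real ^ 'n ^ 'm"
  assumes B: "convex B" and feasible: "solution_set A c \<noteq> {}"
    and blocked: "B \<inter> solution_set A c = {}"
  obtains J where "surjective_set A J" "B \<inter> row_solutions A J c = {}"
proof -
  define blocks where "blocks J \<longleftrightarrow> B \<inter> row_solutions A J c = {}" for J
  have "blocks UNIV" using blocked by (simp add: blocks_def row_solutions_UNIV)
  then obtain J where J: "blocks J" and min: "\<And>K. blocks K \<Longrightarrow> card J \<le> card K"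
    using ex_has_least_nat[of blocks UNIV card] by blast
  have "surjective_set A J"
  proof (rule ccontr)
    assume "\<not> surjective_set A J"
    then obtain l where l0: "l \<noteq> 0" and lnn: "\<And>i. 0 \<le> l $ i"
      and lJ: "\<And>i. i \<notin> J \<Longrightarrow> l $ i = 0" and lA: "\<And>x. l \<bullet> (A *v x) = 0"
      by (rule not_surjective_row_relation) blast
    have "\<exists>z \<in> B. z \<in> row_solutions A (J - {k}) c" if "k \<in> J" for k
    proof -
      have "card (J - {k}) < card J" by (intro card_Diff1_less) (simp_all add: that)
      then have "\<not> blocks (J - {k})" using min leD by blast
      then show ?thesis by (auto simp: blocks_def)
    qed
    then obtain z where zB: "\<And>k. k \<in> J \<Longrightarrow> z k \<in> B"
      and zsol: "\<And>k. k \<in> J \<Longrightarrow> z k \<in> row_solutions A (J - {k}) c" by metis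
    define F where "F = (\<lambda>x. A *v x - c) ` (convex hull (z ` J))"
    define Q where "Q = {w :: real ^ 'm. \<forall>i\<in>J. w $ i \<le> 0}"
    obtain i0 where "l $ i0 \<noteq> 0" using l0 by (auto simp: vec_eq_iff)
    then have "J \<noteq> {}" using lJ by blast
    then have "F \<noteq> {}" by (simp add: F_def)
    have F_image: "F = (\<lambda>w. w - c) ` (*v) A ` (convex hull (z ` J))"
      by (simp add: F_def image_image)
    have "convex F"
      unfolding F_image
      by (intro convex_translation_subtract convex_linear_image convex_convex_hull) simp
    have "compact F"
      unfolding F_def
      by (intro compact_continuous_image finite_imp_compact_convex_hull continuous_intros
          matrix_vector_mult_linear_continuous_on) auto
    have "closed Q"
    proof -
      have "Q = (\<Inter>i\<in>J. {w. w $ i \<le> 0})" by (auto simp: Q_def)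
      moreover have "closed {w :: real ^ 'm. w $ i \<le> 0}" for i
        by (intro closed_Collect_le continuous_intros)
      ultimately show ?thesis by auto
    qed
    have "convex Q"
      unfolding Q_def convex_def
      by (auto intro!: add_nonpos_nonpos mult_nonneg_nonpos)
    have "convex hull (z ` J) \<subseteq> B" using zB B by (intro hull_minimal) auto
    then have "Q \<inter> F = {}" using J by (auto simp: Q_def F_def blocks_def row_solutions_def)
    then obtain m b where mQ: "\<And>w. w \<in> Q \<Longrightarrow> m \<bullet> w < b" and mF: "\<And>w. w \<in> F \<Longrightarrow> b < m \<bullet> w"
      using separating_hyperplane_closed_compact[OF \<open>convex Q\<close> \<open>closed Q\<close> \<open>convex F\<close> \<open>compact F\<close>
          \<open>F \<noteq> {}\<close>] by blast
    have b: "0 < b" using mQ[of 0] by (simp add: Q_def)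
    have orthant: "m $ i * s \<le> 0" if "i \<in> J \<Longrightarrow> s \<le> 0" for i s
    proof (rule ccontr)
      assume neg: "\<not> m $ i * s \<le> 0"
      define t where "t = b / (m $ i * s)"
      have "0 \<le> t" using neg b by (simp add: t_def)
      then have "axis i (t * s) \<in> Q"
        using that by (auto simp: Q_def axis_def mult_nonneg_nonpos)
      then have "m \<bullet> axis i (t * s) < b" by (rule mQ)
      moreover have "m \<bullet> axis i (t * s) = b"
        using neg by (cases "m $ i = 0"; cases "s = 0") (simp_all add: inner_axis t_def)
      ultimately show False by simp
    qed
    have mnn: "0 \<le> m $ i" for i using orthant[of i "-1"] by simp
    have mJ: "m $ i = 0" if "i \<notin> J" for i
      using that orthant[of i 1] orthant[of i "-1"] by simp
    define S where "S = {i. 0 < l $ i}"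
    have "i0 \<in> S" using lnn[of i0] \<open>l $ i0 \<noteq> 0\<close> by (simp add: S_def)
    then obtain k where kS: "k \<in> S" and kmin: "\<And>i. i \<in> S \<Longrightarrow> m $ k / l $ k \<le> m $ i / l $ i"
      using ex_min_if_finite[of "(\<lambda>i. m $ i / l $ i) ` S"] by (force simp: not_less)
    define t where "t = m $ k / l $ k"
    have lk: "0 < l $ k" using kS by (simp add: S_def)
    have kJ: "k \<in> J" using lk lJ by force
    define w where "w = A *v z k - c"
    have "m \<bullet> w > 0"
    proof -
      have "w \<in> F" unfolding w_def F_def using kJ by (intro imageI hull_inc) simp
      from mF[OF this] b show ?thesis by simp
    qed
    moreover have "l \<bullet> w \<le> 0"
    proof -
      from feasible obtain x0 where "A *v x0 \<le> c" by (auto simp: solution_set_def)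
      then have "l \<bullet> (A *v x0) \<le> l \<bullet> c"
        unfolding inner_vec_def using lnn
        by (intro sum_mono) (auto simp: less_eq_vec_def intro!: mult_left_mono)
      then show ?thesis by (simp add: w_def inner_diff_right lA)
    qed
    moreover have "0 \<le> t" using mnn[of k] lk by (simp add: t_def)
    ultimately have "0 < (m - t *\<^sub>R l) \<bullet> w"
      by (smt (verit) inner_diff_left inner_scaleR_left mult_nonneg_nonpos)
    moreover have "(m - t *\<^sub>R l) \<bullet> w \<le> 0"
      unfolding inner_vec_def
    proof (intro sum_nonpos)
      fix i
      have coeff: "0 \<le> (m - t *\<^sub>R l) $ i"
      proof (cases "i \<in> S")
        case True
        then have "t \<le> m $ i / l $ i" and "0 < l $ i"
          using kmin by (simp_all add: t_def S_def)
        then show ?thesis by (simp add: field_simps)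
      next
        case False
        then have "l $ i = 0" using lnn[of i] by (simp add: S_def)
        with mnn show ?thesis by simp
      qed
      consider "i = k" | "i \<notin> J" | "i \<in> J" "i \<noteq> k" by blast
      then show "inner ((m - t *\<^sub>R l) $ i) (w $ i) \<le> 0"
      proof cases
        case 1
        then show ?thesis using lk by (simp add: t_def)
      next
        case 2
        then show ?thesis by (simp add: lJ mJ)
      next
        case 3
        then have "w $ i \<le> 0" using zsol[OF kJ] by (simp add: w_def row_solutions_def)
        with coeff show ?thesis by (simp add: mult_nonneg_nonpos)
      qed
    qed
    ultimately show False by simp
  qed
  with J show thesis using that by (simp add: blocks_def)
qed

section \<open>The maxima and minima in the Hoffman constant are attained\<close>

definition least_norm ::
  "(real ^ 'n \<Rightarrow> real) \<Rightarrow> real ^ 'n ^ 'm \<Rightarrow> 'm set \<Rightarrow> real ^ 'm \<Rightarrow> real" where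
  "least_norm N A J v = (LEAST r. \<exists>x. x \<in> row_solutions A J v \<and> r = N x)"

lemma hoffman_set_least_norm:
  assumes "J \<noteq> {}"
  shows "hoffman_set Nn Nm A J = (GREATEST h. \<exists>v. Nm v \<le> 1 \<and> h = least_norm Nn A J v)"
  using assms by (simp add: hoffman_set_def least_norm_def row_solutions_def subvector_def)

context
  fixes A :: "real ^ 'n ^ 'm" and Nn :: "real ^ 'n \<Rightarrow> real" and Nm :: "real ^ 'm \<Rightarrow> real"
  assumes Nn: "is_norm Nn" and Nm: "is_norm Nm"
begin

lemma least_norm_attained:
  assumes "surjective_set A J"
  obtains x where "x \<in> row_solutions A J v" "Nn x = least_norm Nn A J v"
    "\<And>y. y \<in> row_solutions A J v \<Longrightarrow> least_norm Nn A J v \<le> Nn y"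
proof -
  have "row_solutions A J v \<noteq> {}" using assms by (simp add: surjective_set_iff)
  then obtain x where x: "x \<in> row_solutions A J v"
    and le: "\<And>y. y \<in> row_solutions A J v \<Longrightarrow> Nn x \<le> Nn y"
    using is_norm_attains_least[OF Nn row_solutions_closed] by blast
  have "least_norm Nn A J v = Nn x"
    unfolding least_norm_def by (rule Least_equality) (use x le in auto)
  with x le show thesis using that by simp
qed

text \<open>
  The least norm is a convex function of the right-hand side, being a partial minimum of a
  jointly convex problem, and finite convex functions are continuous.
\<close>

lemma least_norm_continuous_on:
  assumes "surjective_set A J"
  shows "continuous_on S (least_norm Nn A J)"
proof -
  have "convex_on UNIV (least_norm Nn A J)"
  proof (rule convex_onI)
    fix t :: real and v w :: "real ^ 'm"
    assume t: "0 < t" "t < 1"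
    obtain x where x: "x \<in> row_solutions A J v" "Nn x = least_norm Nn A J v"
      using least_norm_attained[OF assms] by blast
    obtain y where y: "y \<in> row_solutions A J w" "Nn y = least_norm Nn A J w"
      using least_norm_attained[OF assms] by blast
    have "least_norm Nn A J ((1 - t) *\<^sub>R v + t *\<^sub>R w) \<le> Nn ((1 - t) *\<^sub>R x + t *\<^sub>R y)"
      using least_norm_attained[OF assms] row_solutions_segment[OF x(1) y(1)] t
      by (metis less_imp_le)
    also have "\<dots> \<le> (1 - t) * Nn x + t * Nn y" using t by (intro is_norm_segment[OF Nn]) auto
    finally show "least_norm Nn A J ((1 - t) *\<^sub>R v + t *\<^sub>R w)
        \<le> (1 - t) * least_norm Nn A J v + t * least_norm Nn A J w"
      using x y by simp
  qed simp
  then show ?thesis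
    using convex_on_continuous[OF open_UNIV] continuous_on_subset by blast
qed

lemma hoffman_set_attained:
  assumes "surjective_set A J" "J \<noteq> {}"
  obtains v where "Nm v \<le> 1" "least_norm Nn A J v = hoffman_set Nn Nm A J"
    "\<And>w. Nm w \<le> 1 \<Longrightarrow> least_norm Nn A J w \<le> hoffman_set Nn Nm A J"
proof -
  have "{v. Nm v \<le> 1} \<noteq> {}" using is_norm_zero[OF Nm] by (auto intro!: exI[of _ 0])
  then obtain v where v: "Nm v \<le> 1"
    and le: "\<And>w. Nm w \<le> 1 \<Longrightarrow> least_norm Nn A J w \<le> least_norm Nn A J v"
    using continuous_attains_sup[OF is_norm_sublevel_compact[OF Nm] _
        least_norm_continuous_on[OF assms(1)]] by blast
  have "hoffman_set Nn Nm A J = least_norm Nn A J v"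
    unfolding hoffman_set_least_norm[OF assms(2)]
    by (rule Greatest_equality) (use v le in auto)
  with v le show thesis using that by simp
qed

lemma least_norm_le_hoffman_set:
  assumes J: "surjective_set A J" "J \<noteq> {}"
  shows "least_norm Nn A J y \<le> hoffman_set Nn Nm A J * Nm y"
proof (cases "y = 0")
  case True
  obtain x where "least_norm Nn A J 0 \<le> Nn (0 *\<^sub>R x)"
    using least_norm_attained[OF J(1), of 0]
      row_solutions_scale[of _ A J 0 0] by (metis order_refl scaleR_zero_left)
  with True show ?thesis by (simp add: is_norm_zero[OF Nn] is_norm_zero[OF Nm])
next
  case False
  then have pos: "0 < Nm y"
    using is_norm_eq_zero[OF Nm, of y] is_norm_nonneg[OF Nm, of y] by simp
  define v where "v = inverse (Nm y) *\<^sub>R y"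
  have v: "Nm v = 1" using pos by (simp add: v_def is_norm_scale[OF Nm])
  have y: "y = Nm y *\<^sub>R v" using pos by (simp add: v_def)
  obtain x where x: "x \<in> row_solutions A J v" "Nn x = least_norm Nn A J v"
    using least_norm_attained[OF J(1)] by blast
  have "Nm y *\<^sub>R x \<in> row_solutions A J y"
    using row_solutions_scale[OF x(1), of "Nm y"] pos y by simp
  then have "least_norm Nn A J y \<le> Nn (Nm y *\<^sub>R x)"
    using least_norm_attained[OF J(1)] by metis
  also have "\<dots> = Nm y * least_norm Nn A J v" using x pos by (simp add: is_norm_scale[OF Nn])
  also have "\<dots> \<le> Nm y * hoffman_set Nn Nm A J"
    using hoffman_set_attained[OF J] v pos
    by (metis less_imp_le mult_left_mono order_refl)
  finally show ?thesis by (simp add: mult.commute)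
qed

lemma finite_hoffman_sets: "finite {hoffman_set Nn Nm A J | J. surjective_set A J}"
  by simp

lemma surjective_set_empty: "surjective_set A {}"
  by (simp add: surjective_set_iff row_solutions_def)

lemma hoffman_set_le_hoffman:
  assumes "surjective_set A J"
  shows "hoffman_set Nn Nm A J \<le> hoffman Nn Nm A"
  unfolding hoffman_def using assms by (intro Max_ge finite_hoffman_sets) auto

lemma hoffman_nonneg: "0 \<le> hoffman Nn Nm A"
  using hoffman_set_le_hoffman[OF surjective_set_empty] by (simp add: hoffman_set_def)

lemma hoffman_attained:
  obtains J where "surjective_set A J" "hoffman Nn Nm A = hoffman_set Nn Nm A J"
proof -
  have "hoffman Nn Nm A \<in> {hoffman_set Nn Nm A J | J. surjective_set A J}"
    unfolding hoffman_def using surjective_set_empty by (intro Max_in finite_hoffman_sets) auto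
  then show thesis using that by blast
qed

section \<open>The error bound and its tightness\<close>

text \<open>
  The blocking rows are chosen for \<open>b - A u\<close> alone, so that one set \<open>J\<close> serves all
  \<open>y \<le> b - A u\<close>; a solution of the subsystem for \<open>y\<close> is one for \<open>b - A u\<close> and is
  therefore outside the blocked ball.
\<close>

lemma hoffman_bound_slack:
  assumes P: "solution_set A b \<noteq> {}" and y: "y \<le> b - A *v u"
  shows "dist_to Nn u (solution_set A b) \<le> hoffman Nn Nm A * Nm y"
proof -
  define c where "c = b - A *v u"
  define r where "r = dist_to Nn u (solution_set A b)"
  have shift: "u + z \<in> solution_set A b \<longleftrightarrow> z \<in> solution_set A c" for z
    by (simp add: solution_set_def c_def matrix_vector_right_distrib less_eq_vec_def
        algebra_simps)
  have "{z. Nn z < r} \<inter> solution_set A c = {}"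
  proof -
    have "r \<le> Nn z" if "z \<in> solution_set A c" for z
      using dist_to_le[OF Nn, of "u + z" "solution_set A b" u] that shift
      by (simp add: r_def is_norm_minus[OF Nn])
    then show ?thesis by force
  qed
  moreover have "solution_set A c \<noteq> {}"
    using P shift by (metis add_diff_cancel_left' diff_add_cancel add.commute ex_in_conv)
  ultimately obtain J where J: "surjective_set A J"
    and block: "{z. Nn z < r} \<inter> row_solutions A J c = {}"
    using surjective_blocking_rows[OF is_norm_ball_convex[OF Nn]] by metis
  have "r \<le> hoffman Nn Nm A * Nm y"
  proof (cases "J = {}")
    case True
    (* nothing is required of a solution, so only an empty ball can be blocked *)
    with block have "\<not> Nn 0 < r" by (auto simp: row_solutions_def)
    then have "r \<le> 0" by (simp add: is_norm_zero[OF Nn])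
    also have "0 \<le> hoffman Nn Nm A * Nm y" using hoffman_nonneg is_norm_nonneg[OF Nm] by simp
    finally show ?thesis .
  next
    case False
    obtain x where x: "x \<in> row_solutions A J y" "Nn x = least_norm Nn A J y"
      using least_norm_attained[OF J] by blast
    have "x \<in> row_solutions A J c"
      using x(1) y unfolding row_solutions_def c_def less_eq_vec_def by (auto intro: order_trans)
    with block have "r \<le> Nn x" by force
    also have "\<dots> \<le> hoffman_set Nn Nm A J * Nm y"
      using x(2) least_norm_le_hoffman_set[OF J False] by simp
    also have "\<dots> \<le> hoffman Nn Nm A * Nm y"
      using hoffman_set_le_hoffman[OF J] is_norm_nonneg[OF Nm] by (intro mult_right_mono)
    finally show ?thesis .
  qed
  then show ?thesis by (simp add: r_def)
qed

lemma hoffman_bound: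
  assumes "solution_set A b \<noteq> {}"
  shows "dist_to Nn u (solution_set A b) \<le> hoffman Nn Nm A * dist_to Nm b (upper_set (A *v u))"
proof -
  have slack: "dist_to Nn u (solution_set A b) \<le> hoffman Nn Nm A * Nm (b - w)"
    if "w \<in> upper_set (A *v u)" for w
    using that by (intro hoffman_bound_slack[OF assms]) (auto simp: upper_set_def less_eq_vec_def)
  have ne: "upper_set (A *v u) \<noteq> {}" by (auto simp: upper_set_def)
  show ?thesis
  proof (cases "hoffman Nn Nm A = 0")
    case True
    then show ?thesis using slack ne by auto
  next
    case False
    with hoffman_nonneg have pos: "0 < hoffman Nn Nm A" by simp
    have "dist_to Nn u (solution_set A b) / hoffman Nn Nm A \<le> dist_to Nm b (upper_set (A *v u))"
      unfolding dist_to_def[of Nm]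
      by (rule cINF_greatest[OF ne]) (use slack pos in \<open>simp add: field_simps\<close>)
    with pos show ?thesis by (simp add: field_simps)
  qed
qed

text \<open>
  The point \<open>y + (b - y)\<^sub>+\<close> of \<open>y + \<real>\<^sup>m\<^sub>+\<close> differs from \<open>b\<close> by the residual
  \<open>(y - b)\<^sub>+\<close>.
\<close>

lemma dist_upper_set_le_residual: "dist_to Nm b (upper_set y) \<le> Nm (pos_part (y - b))"
proof -
  have "y + pos_part (b - y) \<in> upper_set y"
    by (auto simp: upper_set_def pos_part_def less_eq_vec_def)
  then have "dist_to Nm b (upper_set y) \<le> Nm (b - (y + pos_part (b - y)))"
    by (rule dist_to_le[OF Nm])
  also have "b - (y + pos_part (b - y)) = - pos_part (y - b)"
    by (simp add: pos_part_def vec_eq_iff max_def)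
  finally show ?thesis by (simp add: is_norm_minus[OF Nm])
qed

lemma hoffman_bound_tight:
  assumes pos: "0 < hoffman Nn Nm A"
  shows "\<exists>b u. solution_set A b \<noteq> {} \<and> u \<notin> solution_set A b \<and>
    dist_to Nn u (solution_set A b) = hoffman Nn Nm A * dist_to Nm b (upper_set (A *v u))"
proof -
  define H where "H = hoffman Nn Nm A"
  obtain J where J: "surjective_set A J" and HJ: "H = hoffman_set Nn Nm A J"
    unfolding H_def by (rule hoffman_attained)
  have "J \<noteq> {}" using pos HJ by (auto simp: hoffman_set_def H_def)
  with J obtain v where v: "Nm v \<le> 1" "least_norm Nn A J v = H"
    using hoffman_set_attained HJ by metis
  obtain x where x: "x \<in> row_solutions A J v" "Nn x = H"
    and least: "\<And>y. y \<in> row_solutions A J v \<Longrightarrow> H \<le> Nn y"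
    using least_norm_attained[OF J, of v] v(2) by metis
  define b where "b = (\<chi> i. if i \<in> J then v $ i else max (v $ i) ((A *v x) $ i))"
  have xb: "x \<in> solution_set A b"
    using x(1) by (auto simp: solution_set_def less_eq_vec_def b_def row_solutions_def)
  have large: "H \<le> Nn y" if "y \<in> solution_set A b" for y
  proof (rule least)
    show "y \<in> row_solutions A J v"
      using that unfolding solution_set_def less_eq_vec_def row_solutions_def b_def
      by (auto split: if_splits)
  qed
  have lower: "H \<le> dist_to Nn 0 (solution_set A b)"
    unfolding dist_to_def
    by (rule cINF_greatest) (use xb large in \<open>auto simp: is_norm_minus[OF Nn]\<close>)
  have upper: "dist_to Nn 0 (solution_set A b) \<le> H * dist_to Nm b (upper_set (A *v 0))"
    unfolding H_def using xb by (intro hoffman_bound) auto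
  have "dist_to Nm b (upper_set (A *v 0)) \<le> Nm (b - (b - v))"
    by (rule dist_to_le[OF Nm]) (auto simp: upper_set_def b_def less_eq_vec_def)
  with v(1) have "dist_to Nm b (upper_set (A *v 0)) \<le> 1" by simp
  with pos have "H * dist_to Nm b (upper_set (A *v 0)) \<le> H" by (simp add: H_def)
  with lower upper have "dist_to Nn 0 (solution_set A b) = H * dist_to Nm b (upper_set (A *v 0))"
    by simp
  moreover have "0 \<notin> solution_set A b"
    using large[of 0] pos by (auto simp: H_def is_norm_zero[OF Nn])
  ultimately show ?thesis using xb H_def by blast
qed

end

theorem proposition1:
  fixes A :: "real ^ 'n ^ 'm"
    and Nn :: "real ^ 'n \<Rightarrow> real"
    and Nm :: "real ^ 'm \<Rightarrow> real"
  assumes "is_norm Nn" and "is_norm Nm"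
  shows "(\<forall>b u. solution_set A b \<noteq> {} \<longrightarrow>
            dist_to Nn u (solution_set A b)
              \<le> hoffman Nn Nm A * dist_to Nm b (upper_set (A *v u)) \<and>
            hoffman Nn Nm A * dist_to Nm b (upper_set (A *v u))
              \<le> hoffman Nn Nm A * Nm (pos_part (A *v u - b))) \<and>
         (hoffman Nn Nm A > 0 \<longrightarrow>
            (\<exists>b u. solution_set A b \<noteq> {} \<and> u \<notin> solution_set A b \<and>
               dist_to Nn u (solution_set A b)
                 = hoffman Nn Nm A * dist_to Nm b (upper_set (A *v u))))"
  using hoffman_bound[OF assms] hoffman_bound_tight[OF assms]
    mult_left_mono[OF dist_upper_set_le_residual[OF assms] hoffman_nonneg[OF assms]]
  by blast

end
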